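(* For every integer $n\geq 3$, the mixed cycles $C_{2n}$ and $C^{2}_{2n}$ are not determined by their Hermitian spectrum (not DHS).
   Context: A mixed graph has undirected edges and directed edges (ordered pairs $(x,y)$). For vertices $v_1,\dots,v_n$, its Hermitian adjacency matrix $H(X)$ has $(j,k)$ entry $1$ if $v_jv_k$ is an undirected edge, $i$ if $(v_j,v_k)$ is a directed edge, $-i$ if $(v_k,v_j)$ is a directed edge, $0$ otherwise; $\mathrm{Spec}_H(X)$ is its multiset of eigenvalues. Mixed graphs $X,Y$ on the same vertex set are switching equivalent if $H(X)=D^{-1}H(Y)D$ for a diagonal $D$ with diagonal entries in $\{\pm1,\pm i\}$. A mixed graph $X$ is DHS if every mixed graph $Y$ with $\mathrm{Spec}_H(Y)=\mathrm{Spec}_H(X)$ is switching equivalent to a mixed graph isomorphic to $X$. $C_m$ is the cycle of order $m$ with all edges undirected; $C^2_m$ is the mixed cycle of order $m$ with two consecutive directed edges $(u,v),(v,w)$ with the same direction and all other edges undirected. *)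

theory Defs
  imports "Jordan_Normal_Form.Char_Poly" Complex_Main
begin

record 'a mixed_graph =
  verts :: "'a set"
  uedges :: "'a set set"
  arcs :: "('a \<times> 'a) set"

text \<open>
  Finite, without loops, and any two vertices are joined by at most one edge: an undirected edge
  or an arc in one of the two directions. So at most one case of the definition of the Hermitian
  adjacency matrix applies to each entry.
\<close>
definition mixed_graph :: "'a mixed_graph \<Rightarrow> bool" where
  "mixed_graph X \<longleftrightarrow>
     finite (verts X) \<and>
     (\<forall>e \<in> uedges X. e \<subseteq> verts X \<and> card e = 2) \<and>
     (\<forall>(x, y) \<in> arcs X. x \<in> verts X \<and> y \<in> verts X \<and> x \<noteq> y \<and>
        (y, x) \<notin> arcs X \<and> {x, y} \<notin> uedges X)"

text \<open>
  The vertices are listed in increasing order. Another listing conjugates the matrix by a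
  permutation matrix, so the spectrum and switching equivalence do not depend on the order.
\<close>
definition hermitian_adjacency :: "'a::linorder mixed_graph \<Rightarrow> complex mat" where
  "hermitian_adjacency X =
     (let vs = sorted_list_of_set (verts X) in
      mat (card (verts X)) (card (verts X))
        (\<lambda>(j, k). if {vs ! j, vs ! k} \<in> uedges X then 1
                  else if (vs ! j, vs ! k) \<in> arcs X then \<i>
                  else if (vs ! k, vs ! j) \<in> arcs X then - \<i>
                  else 0))"

text \<open>Eigenvalues with algebraic multiplicity, as roots of the characteristic polynomial.\<close>
definition Spec_H :: "'a::linorder mixed_graph \<Rightarrow> complex multiset" where
  "Spec_H X = proots (char_poly (hermitian_adjacency X))"

definition switching_equivalent ::
  "'a::linorder mixed_graph \<Rightarrow> 'a mixed_graph \<Rightarrow> bool" where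
  "switching_equivalent X Y \<longleftrightarrow>
     verts X = verts Y \<and>
     (\<exists>D D'. D \<in> carrier_mat (card (verts X)) (card (verts X)) \<and>
        D' \<in> carrier_mat (card (verts X)) (card (verts X)) \<and>
        diagonal_mat D \<and>
        (\<forall>j < card (verts X). D $$ (j, j) \<in> {1, -1, \<i>, -\<i>}) \<and>
        inverts_mat D D' \<and> inverts_mat D' D \<and>
        hermitian_adjacency X = D' * hermitian_adjacency Y * D)"

definition mixed_graph_iso :: "'a mixed_graph \<Rightarrow> 'b mixed_graph \<Rightarrow> bool" where
  "mixed_graph_iso X Y \<longleftrightarrow>
     (\<exists>f. bij_betw f (verts X) (verts Y) \<and>
        uedges Y = (\<lambda>e. f ` e) ` uedges X \<and>
        arcs Y = (\<lambda>(x, y). (f x, f y)) ` arcs X)"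

text \<open>
  Letting \<open>Y\<close> range over mixed graphs with the same vertex type as \<open>X\<close> loses nothing: mixed graphs
  with the same spectrum have the same order, so every competitor has an isomorphic copy there.
\<close>
definition DHS :: "'a::linorder mixed_graph \<Rightarrow> bool" where
  "DHS X \<longleftrightarrow>
     (\<forall>Y :: 'a mixed_graph. mixed_graph Y \<and> Spec_H Y = Spec_H X \<longrightarrow>
        (\<exists>Z :: 'a mixed_graph. mixed_graph_iso Z X \<and> switching_equivalent Y Z))"

text \<open>Both cycles are meant for \<open>m \<ge> 3\<close>.\<close>
definition undirected_cycle :: "nat \<Rightarrow> nat mixed_graph" where
  "undirected_cycle m = \<lparr>verts = {..<m}, uedges = {{j, (j + 1) mod m} | j. j < m}, arcs = {}\<rparr>"

definition mixed_cycle2 :: "nat \<Rightarrow> nat mixed_graph" where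
  "mixed_cycle2 m = \<lparr>verts = {..<m},
     uedges = {{j, (j + 1) mod m} | j. 2 \<le> j \<and> j < m},
     arcs = {(0, 1), (1, 2)}\<rparr>"

lemma card_cycle_edge:
  fixes m j :: nat
  assumes "m \<ge> 3" "j < m"
  shows "card {j, (j + 1) mod m} = 2"
proof -
  have "j \<noteq> (j + 1) mod m"
    using assms by (cases "j + 1 = m") auto
  then show ?thesis by simp
qed

lemma mixed_graph_undirected_cycle: "m \<ge> 3 \<Longrightarrow> mixed_graph (undirected_cycle m)"
  by (auto simp: mixed_graph_def undirected_cycle_def dest: card_cycle_edge)

lemma mixed_graph_mixed_cycle2:
  assumes "m \<ge> 3"
  shows "mixed_graph (mixed_cycle2 m)"
proof -
  have "{0, 1} \<noteq> {j, (j + 1) mod m}" "{1, 2} \<noteq> {j, (j + 1) mod m}"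
    if "2 \<le> j" "j < m" for j
    using that assms by (cases "j + 1 = m"; auto simp: doubleton_eq_iff)+
  then show ?thesis
    using assms card_cycle_edge[OF assms] by (auto simp: mixed_graph_def mixed_cycle2_def)
qed

end

theory Submission
  imports Defs
begin

text \<open>
  Both cycles of order \<open>2 n\<close> are cospectral to a disjoint union of two mixed cycles of order \<open>n\<close>:
  \<open>C\<^sub>2\<^sub>n\<close> to \<open>C\<^sub>n\<close> together with a cycle of weight \<open>-1\<close>, and \<open>C\<^sup>2\<^sub>2\<^sub>n\<close> to two cycles with a single
  arc each, of weights \<open>\<i>\<close> and \<open>-\<i>\<close>. Indeed the \<open>2 n\<close>-cycle covers the \<open>n\<close>-cycle twice, so its
  adjacency matrix commutes with a twisted shift by \<open>n\<close>, and the two eigenspaces of the shift carry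
  the adjacency matrices of the two smaller cycles. Switching preserves the zero pattern of the
  matrix, so a disconnected graph is not switching equivalent to a cycle.
\<close>

section \<open>Graphs of weighted permutations without short cycles\<close>

definition long_perm :: "nat \<Rightarrow> (nat \<Rightarrow> nat) \<Rightarrow> bool" where
  "long_perm m \<sigma> \<longleftrightarrow> bij_betw \<sigma> {..<m} {..<m} \<and> (\<forall>j<m. \<sigma> j \<noteq> j \<and> \<sigma> (\<sigma> j) \<noteq> j)"

text \<open>Here \<open>w j\<close> is meant as the matrix entry at \<open>(j, \<sigma> j)\<close>;
  a mixed graph cannot realise the weight -1. When \<open>\<sigma>\<close> is a
  \<open>long_perm\<close>, all its cycles have length at least 3, so distinct \<open>j < m\<close>
  give distinct edges and the entries do not clash.\<close>

definition perm_graph :: "nat \<Rightarrow> (nat \<Rightarrow> nat) \<Rightarrow> (nat \<Rightarrow> complex) \<Rightarrow> nat mixed_graph" where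
  "perm_graph m \<sigma> w = \<lparr>verts = {..<m}, uedges = {{j, \<sigma> j} | j. j < m \<and> w j = 1},
     arcs = {(j, \<sigma> j) | j. j < m \<and> w j = \<i>} \<union> {(\<sigma> j, j) | j. j < m \<and> w j = - \<i>}\<rparr>"

definition rotation :: "nat \<Rightarrow> nat \<Rightarrow> nat" where
  "rotation m j = (if Suc j = m then 0 else Suc j)"

definition double_rotation :: "nat \<Rightarrow> nat \<Rightarrow> nat" where
  "double_rotation n j = (if Suc j = n then 0 else if Suc j = 2 * n then n else Suc j)"

lemma long_permD:
  assumes "long_perm m \<sigma>" "j < m"
  shows "\<sigma> j < m" "\<sigma> j \<noteq> j" "\<sigma> (\<sigma> j) \<noteq> j" "\<exists>i<m. j = \<sigma> i"
    "k < m \<Longrightarrow> \<sigma> j = \<sigma> k \<longleftrightarrow> j = k"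
proof -
  have b: "bij_betw \<sigma> {..<m} {..<m}" using assms by (simp add: long_perm_def)
  then have im: "\<sigma> ` {..<m} = {..<m}" and inj: "inj_on \<sigma> {..<m}"
    by (auto simp: bij_betw_def)
  show "\<sigma> j < m" using im assms(2) by blast
  show "\<sigma> j \<noteq> j" "\<sigma> (\<sigma> j) \<noteq> j" using assms by (auto simp: long_perm_def)
  have "j \<in> \<sigma> ` {..<m}" using im assms(2) by simp
  then show "\<exists>i<m. j = \<sigma> i" by auto
  show "k < m \<Longrightarrow> \<sigma> j = \<sigma> k \<longleftrightarrow> j = k" using inj assms(2) by (auto simp: inj_on_def)
qed

lemma long_permI:
  assumes "\<And>j. j < m \<Longrightarrow> \<sigma> j < m" "\<And>j k. j < m \<Longrightarrow> k < m \<Longrightarrow> \<sigma> j = \<sigma> k \<Longrightarrow> j = k"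
    "\<And>j. j < m \<Longrightarrow> \<sigma> j \<noteq> j" "\<And>j. j < m \<Longrightarrow> \<sigma> (\<sigma> j) \<noteq> j"
  shows "long_perm m \<sigma>"
proof -
  have "inj_on \<sigma> {..<m}" using assms(2) by (auto simp: inj_on_def)
  moreover have "\<sigma> ` {..<m} \<subseteq> {..<m}" using assms(1) by auto
  ultimately have "bij_betw \<sigma> {..<m} {..<m}"
    by (simp add: bij_betw_def endo_inj_surj)
  then show ?thesis using assms(3,4) by (simp add: long_perm_def)
qed

lemma long_perm_rotation: "m \<ge> 3 \<Longrightarrow> long_perm m (rotation m)"
  by (rule long_permI) (auto simp: rotation_def split: if_splits)

lemma long_perm_double_rotation: "n \<ge> 3 \<Longrightarrow> long_perm (2 * n) (double_rotation n)"
  by (rule long_permI) (auto simp: double_rotation_def split: if_splits)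

lemma perm_graph_rels:
  assumes "long_perm m \<sigma>" "j < m" "k < m"
  shows "{j, k} \<in> uedges (perm_graph m \<sigma> w) \<longleftrightarrow> (k = \<sigma> j \<and> w j = 1) \<or> (j = \<sigma> k \<and> w k = 1)"
    "(j, k) \<in> arcs (perm_graph m \<sigma> w) \<longleftrightarrow> (k = \<sigma> j \<and> w j = \<i>) \<or> (j = \<sigma> k \<and> w k = - \<i>)"
  using assms(2,3) by (auto simp: perm_graph_def doubleton_eq_iff)

lemma mixed_graph_perm_graph:
  assumes "long_perm m \<sigma>"
  shows "mixed_graph (perm_graph m \<sigma> w)"
proof -
  have "\<i> \<noteq> - \<i>" by (simp add: complex_eq_iff)
  then have "x < m \<and> y < m \<and> x \<noteq> y \<and> (y, x) \<notin> arcs (perm_graph m \<sigma> w) \<and>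
      {x, y} \<notin> uedges (perm_graph m \<sigma> w)" if "(x, y) \<in> arcs (perm_graph m \<sigma> w)" for x y
  proof -
    have xy: "x < m" "y < m"
      using that long_permD(1)[OF assms] by (auto simp: perm_graph_def)
    note D = long_permD[OF assms xy(1)] long_permD[OF assms xy(2)]
    show ?thesis
      using that xy D(2,3) D(7,8) \<open>\<i> \<noteq> - \<i>\<close> perm_graph_rels[OF assms xy] perm_graph_rels[OF assms xy(2,1)]
      by (auto simp: complex_eq_iff)
  qed
  moreover have "e \<subseteq> {..<m} \<and> card e = 2" if e: "e \<in> uedges (perm_graph m \<sigma> w)" for e
  proof -
    obtain j where "j < m" "e = {j, \<sigma> j}" using e by (auto simp: perm_graph_def)
    then show ?thesis using long_permD(1,2)[OF assms, of j] by simp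
  qed
  moreover have "verts (perm_graph m \<sigma> w) = {..<m}" by (simp add: perm_graph_def)
  ultimately show ?thesis unfolding mixed_graph_def by auto
qed

section \<open>Adjacency matrices of permutation graphs and a similarity criterion\<close>

lemma hermitian_adjacency_lessThan:
  assumes "verts X = {..<m}" "j < m" "k < m"
  shows "hermitian_adjacency X $$ (j, k) =
    (if {j, k} \<in> uedges X then 1 else if (j, k) \<in> arcs X then \<i>
     else if (k, j) \<in> arcs X then - \<i> else 0)"
  using assms by (simp add: hermitian_adjacency_def Let_def lessThan_atLeast0)

lemma hermitian_adjacency_carrier:
  "verts X = {..<m} \<Longrightarrow> hermitian_adjacency X \<in> carrier_mat m m"
  by (simp add: hermitian_adjacency_def Let_def)

text \<open>This splits the matrix as S + S*, with S a weighted permutation matrix. At most one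
  summand is nonzero because \<open>\<sigma>\<close> has no 2-cycle.\<close>

lemma hermitian_adjacency_perm_graph:
  assumes "long_perm m \<sigma>" "range w \<subseteq> {1, \<i>, - \<i>}" "j < m" "k < m"
  shows "hermitian_adjacency (perm_graph m \<sigma> w) $$ (j, k) =
    (if k = \<sigma> j then w j else 0) + (if j = \<sigma> k then cnj (w k) else 0)"
proof -
  have V: "verts (perm_graph m \<sigma> w) = {..<m}" by (simp add: perm_graph_def)
  have i: "\<i> \<noteq> 1" "\<i> \<noteq> - \<i>" "- \<i> \<noteq> 1" by (simp_all add: complex_eq_iff)
  have w: "w i \<in> {1, \<i>, - \<i>}" for i using assms(2) by auto
  note entry = hermitian_adjacency_lessThan[OF V assms(3,4)]
    perm_graph_rels[OF assms(1,3,4)] perm_graph_rels[OF assms(1,4,3)]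
  consider "k = \<sigma> j" "j \<noteq> \<sigma> k" | "k \<noteq> \<sigma> j" "j = \<sigma> k" | "k \<noteq> \<sigma> j" "j \<noteq> \<sigma> k"
    using long_permD(3)[OF assms(1,3)] by auto
  then show ?thesis
  proof cases
    case 1
    then show ?thesis using w[of j] i unfolding entry by (simp only: simp_thms if_True if_False) auto
  next
    case 2
    then show ?thesis using w[of k] i unfolding entry by (simp only: simp_thms if_True if_False) auto
  qed (simp add: entry)
qed

lemma perm_graph_adjacent_iff:
  assumes "long_perm m \<sigma>" "range w \<subseteq> {1, \<i>, - \<i>}" "j < m" "k < m"
  shows "hermitian_adjacency (perm_graph m \<sigma> w) $$ (j, k) \<noteq> 0 \<longleftrightarrow> k = \<sigma> j \<or> j = \<sigma> k"
proof -
  have "w i \<in> {1, \<i>, - \<i>}" for i using assms(2) by auto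
  from this[of j] this[of k] have "w j \<noteq> 0" "w k \<noteq> 0" by auto
  moreover have "\<not> (k = \<sigma> j \<and> j = \<sigma> k)" using long_permD(3)[OF assms(1,3)] by auto
  ultimately show ?thesis by (auto simp: hermitian_adjacency_perm_graph[OF assms])
qed

text \<open>Write the two matrices as S + S* and T + T*. The assumption \<open>step\<close> says S P
  = P T. Since all weights have modulus 1, S and T are unitary, so S* P = P T* follows, and P
  intertwines the two sums. By \<open>orth\<close>, P is invertible with inverse P* / r, so the
  matrices are similar.\<close>

lemma Spec_H_perm_graph_eqI:
  fixes P :: "nat \<Rightarrow> nat \<Rightarrow> complex"
  assumes \<sigma>: "long_perm m \<sigma>" and \<tau>: "long_perm m \<tau>"
    and w: "range w \<subseteq> {1, \<i>, - \<i>}" and v: "range v \<subseteq> {1, \<i>, - \<i>}"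
    and step: "\<And>j c. j < m \<Longrightarrow> c < m \<Longrightarrow> w j * P (\<sigma> j) (\<tau> c) = P j c * v c"
    and orth: "\<And>c d. c < m \<Longrightarrow> d < m \<Longrightarrow> (\<Sum>j<m. cnj (P j c) * P j d) = (if c = d then r else 0)"
    and r: "r \<noteq> 0"
  shows "Spec_H (perm_graph m \<tau> v) = Spec_H (perm_graph m \<sigma> w)"
proof -
  let ?A = "hermitian_adjacency (perm_graph m \<sigma> w)"
  let ?B = "hermitian_adjacency (perm_graph m \<tau> v)"
  define M where "M = mat m m (\<lambda>(j, c). P j c)"
  define N where "N = mat m m (\<lambda>(c, j). cnj (P j c) / r)"
  have car: "?A \<in> carrier_mat m m" "?B \<in> carrier_mat m m" "M \<in> carrier_mat m m" "N \<in> carrier_mat m m"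
    by (auto simp: M_def N_def perm_graph_def intro!: hermitian_adjacency_carrier)
  have unit: "cnj (w j) * w j = 1" "v j * cnj (v j) = 1" for j
  proof -
    have "w j \<in> {1, \<i>, - \<i>}" "v j \<in> {1, \<i>, - \<i>}" using w v by auto
    then show "cnj (w j) * w j = 1" "v j * cnj (v j) = 1" by auto
  qed
  have adjoint_step: "cnj (w j) * P j c = P (\<sigma> j) (\<tau> c) * cnj (v c)" if "j < m" "c < m" for j c
  proof -
    have "cnj (w j) * P j c = cnj (w j) * (P j c * v c) * cnj (v c)"
      using unit(2)[of c] by (simp add: mult.assoc)
    also have "\<dots> = (cnj (w j) * w j) * P (\<sigma> j) (\<tau> c) * cnj (v c)"
      by (simp add: step[OF that, symmetric])
    finally show ?thesis using unit(1) by simp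
  qed
  have NM: "N * M = 1\<^sub>m m"
  proof (rule eq_matI)
    fix c d assume cd: "c < dim_row (1\<^sub>m m :: complex mat)" "d < dim_col (1\<^sub>m m :: complex mat)"
    then have "(N * M) $$ (c, d) = (\<Sum>j<m. cnj (P j c) / r * P j d)"
      by (simp add: M_def N_def scalar_prod_def lessThan_atLeast0)
    also have "\<dots> = (\<Sum>j<m. cnj (P j c) * P j d) / r"
      by (simp add: sum_divide_distrib)
    also have "\<dots> = 1\<^sub>m m $$ (c, d)" using cd r by (simp add: orth)
    finally show "(N * M) $$ (c, d) = 1\<^sub>m m $$ (c, d)" .
  qed (auto simp: M_def N_def)
  have MN: "M * N = 1\<^sub>m m" by (rule mat_mult_left_right_inverse[OF car(4,3) NM])
  have comm: "?A * M = M * ?B"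
  proof (rule eq_matI)
    fix j c assume "j < dim_row (M * ?B)" "c < dim_col (M * ?B)"
    then have j: "j < m" and c: "c < m" using car by auto
    \<comment> \<open>Row \<open>j\<close> of \<open>?A\<close> is supported on the successor and
      the predecessor of \<open>j\<close>, and column \<open>c\<close> of \<open>?B\<close> on those
      of \<open>c\<close>; the predecessors \<open>j'\<close> and \<open>c'\<close> locate the
      starred terms in the row and the unstarred ones in the column.\<close>
    obtain j' where j': "j' < m" "j = \<sigma> j'" using long_permD(4)[OF \<sigma> j] by auto
    obtain c' where c': "c' < m" "c = \<tau> c'" using long_permD(4)[OF \<tau> c] by auto
    have ej: "j = \<sigma> l \<longleftrightarrow> l = j'" if "l < m" for l using long_permD(5)[OF \<sigma> j'(1) that] j'(2) by auto
    have ec: "c = \<tau> l \<longleftrightarrow> l = c'" if "l < m" for l using long_permD(5)[OF \<tau> c'(1) that] c'(2) by auto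
    have "(?A * M) $$ (j, c) = (\<Sum>l<m. ?A $$ (j, l) * P l c)"
      using j c car by (simp add: M_def scalar_prod_def lessThan_atLeast0)
    also have "\<dots> = (\<Sum>l<m. (if l = \<sigma> j then w j * P l c else 0) + (if l = j' then cnj (w l) * P l c else 0))"
      using j by (intro sum.cong) (auto simp: hermitian_adjacency_perm_graph[OF \<sigma> w] ej algebra_simps)
    also have "\<dots> = w j * P (\<sigma> j) c + cnj (w j') * P j' c"
      using long_permD(1)[OF \<sigma> j] j' by (simp add: sum.distrib)
    also have "\<dots> = P j c' * v c' + P j (\<tau> c) * cnj (v c)"
      using step[OF j c'(1)] adjoint_step[OF j'(1) c] j' c' by simp
    also have "\<dots> = (\<Sum>l<m. (if l = c' then P j l * v l else 0) + (if l = \<tau> c then P j l * cnj (v c) else 0))"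
      using long_permD(1)[OF \<tau> c] c' by (simp add: sum.distrib)
    also have "\<dots> = (\<Sum>l<m. P j l * ?B $$ (l, c))"
      using c by (intro sum.cong) (auto simp: hermitian_adjacency_perm_graph[OF \<tau> v] ec algebra_simps)
    also have "\<dots> = (M * ?B) $$ (j, c)"
      using j c car by (simp add: M_def scalar_prod_def lessThan_atLeast0)
    finally show "(?A * M) $$ (j, c) = (M * ?B) $$ (j, c)" .
  qed (use car in auto)
  have "?A = ?A * (M * N)" using car(1) by (simp add: MN)
  also have "\<dots> = M * ?B * N" using assoc_mult_mat[OF car(1,3,4)] by (simp add: comm)
  finally have "similar_mat_wit ?A ?B M N"
    using similar_mat_witI[OF MN NM _ car] by blast
  then have "similar_mat ?A ?B" by (auto simp: similar_mat_def)
  then show ?thesis by (simp add: Spec_H_def char_poly_similar)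
qed

section \<open>Switching, isomorphism and connectedness\<close>

lemma switching_equivalent_zero_pattern:
  assumes "switching_equivalent Y Z" "verts Y = {..<m}" "j < m" "k < m"
  shows "hermitian_adjacency Y $$ (j, k) = 0 \<longleftrightarrow> hermitian_adjacency Z $$ (j, k) = 0"
proof -
  let ?Y = "hermitian_adjacency Y" and ?Z = "hermitian_adjacency Z"
  obtain D D' where D: "D \<in> carrier_mat m m" "D' \<in> carrier_mat m m" "diagonal_mat D"
    "\<forall>j<m. D $$ (j, j) \<in> {1, -1, \<i>, -\<i>}" "inverts_mat D D'" "?Y = D' * ?Z * D"
    using assms(1,2) unfolding switching_equivalent_def by auto
  have vZ: "verts Z = {..<m}" using assms(1,2) by (simp add: switching_equivalent_def)
  note car = D(1,2) hermitian_adjacency_carrier[OF assms(2)] hermitian_adjacency_carrier[OF vZ]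
  \<comment> \<open>Clearing the inverse leaves D Y = Z D. Entrywise this is d_j y_jk = z_jk d_k
    with nonzero d_j and d_k.\<close>
  have "D * ?Y = D * D' * ?Z * D"
    using car unfolding D(6) by (smt (verit) assoc_mult_mat mult_carrier_mat)
  also have "\<dots> = ?Z * D" using car D(5) by (simp add: inverts_mat_def)
  finally have eq: "D * ?Y = ?Z * D" .
  have off: "D $$ (a, b) = 0" if "a < m" "b < m" "a \<noteq> b" for a b
    using D(1,3) that by (auto simp: diagonal_mat_def)
  have "(D * ?Y) $$ (j, k) = (\<Sum>l<m. D $$ (j, l) * ?Y $$ (l, k))"
    using assms(3,4) car by (simp add: scalar_prod_def lessThan_atLeast0)
  also have "\<dots> = (\<Sum>l<m. if l = j then D $$ (j, j) * ?Y $$ (j, k) else 0)"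
    using assms(3) off by (intro sum.cong) auto
  finally have 1: "(D * ?Y) $$ (j, k) = D $$ (j, j) * ?Y $$ (j, k)" using assms(3) by simp
  have "(?Z * D) $$ (j, k) = (\<Sum>l<m. ?Z $$ (j, l) * D $$ (l, k))"
    using assms(3,4) car by (simp add: scalar_prod_def lessThan_atLeast0)
  also have "\<dots> = (\<Sum>l<m. if l = k then ?Z $$ (j, k) * D $$ (k, k) else 0)"
    using assms(4) off by (intro sum.cong) auto
  finally have 2: "(?Z * D) $$ (j, k) = ?Z $$ (j, k) * D $$ (k, k)" using assms(4) by simp
  have "D $$ (j, j) \<noteq> 0" "D $$ (k, k) \<noteq> 0" using D(4) assms(3,4) by force+
  then show ?thesis using 1 2 eq by auto
qed

text \<open>Only one direction is claimed: \<open>Z\<close> is not assumed to be a mixed graph, so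
  an edge of \<open>X\<close> may be the image of a pair outside \<open>verts Z\<close>, where
  \<open>f\<close> is arbitrary.\<close>

lemma mixed_graph_iso_adjacent:
  assumes "verts Z = {..<m}" "verts X = {..<m}" "bij_betw f (verts Z) (verts X)"
    "uedges X = (\<lambda>e. f ` e) ` uedges Z" "arcs X = (\<lambda>(x, y). (f x, f y)) ` arcs Z"
    "j < m" "k < m" "hermitian_adjacency Z $$ (j, k) \<noteq> 0"
  shows "hermitian_adjacency X $$ (f j, f k) \<noteq> 0"
proof -
  have "{j, k} \<in> uedges Z \<or> (j, k) \<in> arcs Z \<or> (k, j) \<in> arcs Z"
    using assms(8) by (auto simp: hermitian_adjacency_lessThan[OF assms(1,6,7)] split: if_splits)
  then have "{f j, f k} \<in> uedges X \<or> (f j, f k) \<in> arcs X \<or> (f k, f j) \<in> arcs X"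
    unfolding assms(4,5) by (metis (no_types, lifting) case_prod_conv image_empty image_eqI image_insert)
  moreover have "f j < m" "f k < m" using assms(1-3,6,7) by (auto dest: bij_betwE)
  ultimately show ?thesis by (auto simp: hermitian_adjacency_lessThan[OF assms(2)])
qed

text \<open>The image under \<open>f\<close> of the first small cycle \<open>{..<n}\<close> is
  closed under the rotation, hence is all of \<open>{..<2 * n}\<close>; but \<open>f n\<close> lies
  outside it by injectivity.\<close>

lemma double_rotation_not_switching_equivalent_cycle:
  assumes n: "n \<ge> 3" and w: "range w \<subseteq> {1, \<i>, - \<i>}" and v: "range v \<subseteq> {1, \<i>, - \<i>}"
    and Z: "mixed_graph_iso Z (perm_graph (2 * n) (rotation (2 * n)) w)"
      "switching_equivalent (perm_graph (2 * n) (double_rotation n) v) Z"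
  shows False
proof -
  let ?X = "perm_graph (2 * n) (rotation (2 * n)) w" and ?Y = "perm_graph (2 * n) (double_rotation n) v"
  have V: "verts ?X = {..<2 * n}" "verts ?Y = {..<2 * n}" by (auto simp: perm_graph_def)
  have vZ: "verts Z = {..<2 * n}" using Z(2) V by (simp add: switching_equivalent_def)
  have \<sigma>: "long_perm (2 * n) (rotation (2 * n))" using n by (simp add: long_perm_rotation)
  have \<tau>: "long_perm (2 * n) (double_rotation n)" using n by (rule long_perm_double_rotation)
  obtain f where f: "bij_betw f (verts Z) (verts ?X)" "uedges ?X = (\<lambda>e. f ` e) ` uedges Z"
    "arcs ?X = (\<lambda>(x, y). (f x, f y)) ` arcs Z"
    using Z(1) unfolding mixed_graph_iso_def by auto
  have bf: "bij_betw f {..<2 * n} {..<2 * n}" using f(1) vZ V by simp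
  have fl: "f a < 2 * n" if "a < 2 * n" for a using bij_betwE[OF bf] that by auto
  have finj: "a = b" if "f a = f b" "a < 2 * n" "b < 2 * n" for a b
    using bf that by (auto simp: bij_betw_def inj_on_def)
  have adj: "f b = rotation (2 * n) (f a) \<or> f a = rotation (2 * n) (f b)"
    if ab: "a < 2 * n" "b < 2 * n" "b = double_rotation n a \<or> a = double_rotation n b" for a b
  proof -
    have "hermitian_adjacency ?Y $$ (a, b) \<noteq> 0"
      using ab perm_graph_adjacent_iff[OF \<tau> v] by blast
    then have "hermitian_adjacency Z $$ (a, b) \<noteq> 0"
      using switching_equivalent_zero_pattern[OF Z(2) V(2) ab(1,2)] by simp
    then have "hermitian_adjacency ?X $$ (f a, f b) \<noteq> 0"
      by (rule mixed_graph_iso_adjacent[OF vZ V(1) f ab(1,2)])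
    then show ?thesis using perm_graph_adjacent_iff[OF \<sigma> w fl[OF ab(1)] fl[OF ab(2)]] by simp
  qed
  \<comment> \<open>\<open>Z\<close> may have lost edges to pairs outside its vertex set, so that \<open>f\<close> need not reflect
    adjacency a priori. But every vertex of both graphs has degree two, so \<open>f\<close> maps
    the neighbourhood of \<open>a\<close> onto that of \<open>f a\<close>.\<close>
  have closed: "rotation (2 * n) (f a) \<in> f ` {..<n}" if "a < n" for a
  proof -
    have a: "a < 2 * n" using that by simp
    obtain a' where a': "a' < 2 * n" "a = double_rotation n a'" using long_permD(4)[OF \<tau> a] by auto
    let ?b = "double_rotation n a"
    have b: "?b < 2 * n" "?b \<noteq> a'" using long_permD(1)[OF \<tau> a] long_permD(3)[OF \<tau> a] long_permD(3)[OF \<tau> a'(1)] a' by auto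
    have blk: "?b < n" "a' < n" using that a' by (auto simp: double_rotation_def split: if_splits)
    have "f ?b = rotation (2 * n) (f a) \<or> f a' = rotation (2 * n) (f a)"
    proof (rule ccontr)
      \<comment> \<open>Then \<open>f a\<close> would be the successor of both \<open>f ?b\<close>
        and \<open>f a'\<close>, although \<open>?b\<close> and \<open>a'\<close> are
        distinct.\<close>
      assume "\<not> ?thesis"
      then have "rotation (2 * n) (f ?b) = rotation (2 * n) (f a')"
        using adj[OF a b(1)] adj[OF a a'(1)] a' by auto
      then show False
        using long_permD(5)[OF \<sigma> fl[OF b(1)] fl[OF a'(1)]] finj[OF _ b(1) a'(1)] b(2) by auto
    qed
    then show ?thesis using blk by (metis imageI lessThan_iff)
  qed
  have all: "t < 2 * n \<Longrightarrow> t \<in> f ` {..<n}" for t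
  proof -
    \<comment> \<open>Walking up from \<open>f 0\<close> reaches \<open>2 * n - 1\<close>, whose
      successor wraps round to 0; a second walk from 0 then covers everything.\<close>
    have up: "s + f 0 < 2 * n \<Longrightarrow> s + f 0 \<in> f ` {..<n}" for s
    proof (induction s)
      case (Suc s)
      then obtain a where "a < n" "s + f 0 = f a" by auto
      then show ?case using closed[of a] Suc.prems by (auto simp: rotation_def split: if_splits)
    qed (use n in auto)
    have "2 * n - 1 \<in> f ` {..<n}" using up[of "2 * n - 1 - f 0"] fl[of 0] n by simp
    then obtain a where "a < n" "f a = 2 * n - 1" by auto
    then have 0: "0 \<in> f ` {..<n}" using closed[of a] n by (simp add: rotation_def)
    show "t < 2 * n \<Longrightarrow> t \<in> f ` {..<n}"
    proof (induction t)
      case (Suc t)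
      then obtain a where "a < n" "t = f a" by auto
      then show ?case using closed[of a] Suc.prems by (auto simp: rotation_def split: if_splits)
    qed (use 0 in auto)
  qed
  obtain a where "a < n" "f n = f a" using all[OF fl[of n]] n by auto
  then show False using finj[of n a] n by auto
qed

section \<open>Competitors from the double cover\<close>

lemma not_DHS_perm_graph_rotation:
  assumes n: "n \<ge> 3" and w: "range w \<subseteq> {1, \<i>, - \<i>}" and v: "range v \<subseteq> {1, \<i>, - \<i>}"
    and spec: "Spec_H (perm_graph (2 * n) (double_rotation n) v) =
      Spec_H (perm_graph (2 * n) (rotation (2 * n)) w)"
  shows "\<not> DHS (perm_graph (2 * n) (rotation (2 * n)) w)"
  using mixed_graph_perm_graph[OF long_perm_double_rotation[OF n]] spec
    double_rotation_not_switching_equivalent_cycle[OF n w v]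
  unfolding DHS_def by blast

text \<open>
  Up to the scalars \<open>p\<close> and \<open>q\<close>, the columns of the similarity matrix are indicators of the fibres
  \<open>{k, n + k}\<close> of the double cover; \<open>p\<close> and \<open>q\<close> span the two eigenspaces of the twisted shift.
\<close>
lemma Spec_H_double_rotation_eqI:
  fixes p q :: "nat \<Rightarrow> complex"
  assumes n: "n \<ge> 3" and w: "range w \<subseteq> {1, \<i>, - \<i>}" and v: "range v \<subseteq> {1, \<i>, - \<i>}"
    and norm: "\<And>j. cnj (p j) * p j = 1" "\<And>j. cnj (q j) * q j = 1"
    and orth: "\<And>k. k < n \<Longrightarrow> cnj (p k) * q k + cnj (p (n + k)) * q (n + k) = 0"
    and p: "\<And>j. j < n \<Longrightarrow> w j * p (Suc j) = p j * v j"
      "\<And>j. j < n \<Longrightarrow> w (n + j) * p (rotation (2 * n) (n + j)) = p (n + j) * v j"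
    and q: "\<And>j. j < n \<Longrightarrow> w j * q (Suc j) = q j * v (n + j)"
      "\<And>j. j < n \<Longrightarrow> w (n + j) * q (rotation (2 * n) (n + j)) = q (n + j) * v (n + j)"
  shows "Spec_H (perm_graph (2 * n) (double_rotation n) v) =
      Spec_H (perm_graph (2 * n) (rotation (2 * n)) w)"
proof -
  \<comment> \<open>For indices below \<open>2 * n\<close> the condition means that \<open>j\<close>
    and \<open>c\<close> are congruent modulo \<open>n\<close>. Columns of the first small cycle
    carry \<open>p\<close>, those of the second carry \<open>q\<close>.\<close>
  define P where "P j c = (if j = c \<or> j = n + c \<or> c = n + j then if c < n then p j else q j else 0)" for j c
  have low_or_high: "(\<exists>k<n. j = k) \<or> (\<exists>k<n. j = n + k)" if "j < 2 * n" for j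
    using that by (cases "j < n") (auto intro!: exI[of _ "j - n"])
  have step: "w j * P (rotation (2 * n) j) (double_rotation n c) = P j c * v c"
    if jc: "j < 2 * n" "c < 2 * n" for j c
  proof -
    have next_p: "w j * p (rotation (2 * n) j) = p j * v c" if "c < n" "j = c \<or> j = n + c"
      using p[of c] that n by (auto simp: rotation_def split: if_splits)
    have next_q: "w j * q (rotation (2 * n) j) = q j * v c" if c: "\<not> c < n" "j = c \<or> c = n + j"
    proof -
      obtain k where "k < n" "c = n + k" using low_or_high[OF jc(2)] c(1) by auto
      then show ?thesis using q[of k] c(2) n by (auto simp: rotation_def)
    qed
    have blk: "double_rotation n c < n \<longleftrightarrow> c < n" using jc n by (auto simp: double_rotation_def)
    \<comment> \<open>Both permutations induce the same successor modulo \<open>n\<close>, so they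
      preserve this congruence.\<close>
    have "(rotation (2 * n) j = double_rotation n c \<or> rotation (2 * n) j = n + double_rotation n c
        \<or> double_rotation n c = n + rotation (2 * n) j) \<longleftrightarrow> (j = c \<or> j = n + c \<or> c = n + j)"
      using jc n by (auto simp: rotation_def double_rotation_def)
    then show ?thesis using next_p next_q blk jc by (auto simp: P_def)
  qed
  have "(\<Sum>j<2 * n. cnj (P j c) * P j d) = (if c = d then 2 else 0)" if cd: "c < 2 * n" "d < 2 * n" for c d
  proof -
    obtain k where k: "k < n" "c = k \<or> c = n + k" using low_or_high[OF cd(1)] by auto
    \<comment> \<open>Column \<open>c\<close> lives on one fibre. Two unimodular entries give the
      norm 2; the only other column on that fibre is orthogonal by \<open>orth\<close> or its
      conjugate.\<close>
    have "(\<Sum>j<2 * n. cnj (P j c) * P j d) = (\<Sum>j\<in>{k, n + k}. cnj (P j c) * P j d)"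
      using k by (intro sum.mono_neutral_right) (auto simp: P_def)
    also have "\<dots> = cnj (P k c) * P k d + cnj (P (n + k) c) * P (n + k) d" using k by simp
    also have "\<dots> = (if c = d then 2 else 0)"
    proof -
      have "cnj (q k) * p k + cnj (q (n + k)) * p (n + k) = 0"
        using arg_cong[OF orth[OF k(1)], of cnj] by (simp add: algebra_simps)
      then show ?thesis using k cd norm orth[OF k(1)] by (auto simp: P_def)
    qed
    finally show ?thesis .
  qed
  then show ?thesis
    using n w v step long_perm_rotation[of "2 * n"] long_perm_double_rotation
    by (intro Spec_H_perm_graph_eqI[where P = P and r = 2]) auto
qed

section \<open>The two cycles of the theorem\<close>

lemma undirected_cycle_perm_graph:
  "undirected_cycle m = perm_graph m (rotation m) (\<lambda>_. 1)"
proof -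
  have "(j + 1) mod m = rotation m j" if "j < m" for j using that by (auto simp: rotation_def)
  then show ?thesis by (force simp: undirected_cycle_def perm_graph_def complex_eq_iff)
qed

lemma mixed_cycle2_perm_graph:
  assumes "m \<ge> 3"
  shows "mixed_cycle2 m = perm_graph m (rotation m) (\<lambda>j. if j < 2 then \<i> else 1)"
proof -
  have r: "(j + 1) mod m = rotation m j" if "j < m" for j using that by (auto simp: rotation_def)
  have w: "(if j < 2 then \<i> else 1) = (1::complex) \<longleftrightarrow> 2 \<le> j"
    "(if j < 2 then \<i> else 1) = \<i> \<longleftrightarrow> j = 0 \<or> j = 1"
    "(if j < 2 then \<i> else 1) = - \<i> \<longleftrightarrow> False" for j :: nat
    by (auto simp: complex_eq_iff)
  have "{{j, (j + 1) mod m} | j. 2 \<le> j \<and> j < m} = {{j, rotation m j} | j. j < m \<and> 2 \<le> j}"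
    by (metis (no_types, lifting) r)
  moreover have "{(j, rotation m j) | j. j < m \<and> (j = 0 \<or> j = 1)} = {(0, rotation m 0), (1, rotation m 1)}"
    using assms by auto
  moreover have "rotation m 0 = 1" "rotation m 1 = 2" using assms by (simp_all add: rotation_def)
  ultimately show ?thesis
    unfolding mixed_cycle2_def perm_graph_def w by simp
qed

theorem theorem4p1:
  fixes n :: nat
  assumes "n \<ge> 3"
  shows "\<not> DHS (undirected_cycle (2 * n)) \<and> \<not> DHS (mixed_cycle2 (2 * n))"
proof
  \<comment> \<open>The second small cycle gets weight -1 as a product of two arcs. The values of
    \<open>?q\<close> solve the recursion from \<open>?q 0 = 1\<close>; it closes up after
    \<open>2 * n\<close> steps because (-1)^2 is the weight 1 of the large cycle.\<close>
  let ?v = "\<lambda>c. if c = n \<or> c = Suc n then \<i> else 1"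
  let ?q = "\<lambda>j. if j = 1 then \<i> else if 2 \<le> j \<and> j \<le> n then - 1 else if j = Suc n then - \<i> else 1"
  have "Spec_H (perm_graph (2 * n) (double_rotation n) ?v) =
      Spec_H (perm_graph (2 * n) (rotation (2 * n)) (\<lambda>_. 1))"
    by (rule Spec_H_double_rotation_eqI[where p = "\<lambda>_. 1" and q = ?q])
      (use assms in \<open>auto simp: rotation_def\<close>)
  then show "\<not> DHS (undirected_cycle (2 * n))"
    unfolding undirected_cycle_perm_graph
    by (rule not_DHS_perm_graph_rotation[OF assms, rotated 2]) auto
next
  let ?w = "\<lambda>j::nat. if j < 2 then \<i> else 1"
  let ?v = "\<lambda>c. if c = 0 then \<i> else if c = n then - \<i> else 1"
  \<comment> \<open>Again both start from 1 at 0 and follow the recursion. They close up because the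
    small weights \<i> and -\<i> both square to -1, the product of the weights \<open>?w\<close>
    round the large cycle.\<close>
  let ?p = "\<lambda>j. if 2 \<le> j \<and> j \<le> n then - \<i> else 1"
  let ?q = "\<lambda>j. if j = 1 then - 1 else if 2 \<le> j \<and> j \<le> n then \<i> else 1"
  have "Spec_H (perm_graph (2 * n) (double_rotation n) ?v) =
      Spec_H (perm_graph (2 * n) (rotation (2 * n)) ?w)"
    by (rule Spec_H_double_rotation_eqI[where p = ?p and q = ?q])
      (use assms in \<open>auto simp: rotation_def\<close>)
  moreover have "mixed_cycle2 (2 * n) = perm_graph (2 * n) (rotation (2 * n)) ?w"
    using assms by (intro mixed_cycle2_perm_graph) simp
  ultimately show "\<not> DHS (mixed_cycle2 (2 * n))"
    using not_DHS_perm_graph_rotation[OF assms, of ?w ?v] by auto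
qed

end
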